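(* Let $E$ be a field of characteristic different from two and let $A$ be a non-trivial inverse-closed additive subgroup of $E$. Then either $A$ is a subfield of $E$, or $A$ is the set of elements of trace zero in some quadratic field extension contained in $E$; that is, in the latter case there are subfields $K\subseteq L\subseteq E$ with $[L:K]=2$ such that $A=\{x\in L \mid \mathrm{Tr}_{L/K}(x)=0\}$.
   Context: For a subset $S$ of a field $E$, write $S^{-1}=\{s^{-1}\mid 0\neq s\in S\}$. The subset $S$ is called inverse-closed if $S^{-1}\subseteq S$. An additive subgroup is non-trivial if it is not $\{0\}$. $\mathrm{Tr}_{L/K}$ denotes the trace map of the field extension $L/K$. *)

theory Defs
  imports "HOL-Algebra.Embedded_Algebras" "HOL-Algebra.Elementary_Groups"
begin

(* group.ord is 0 on elements of infinite order, so rings of characteristic zero get 0. *)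
definition characteristic :: "('a, 'b) ring_scheme \<Rightarrow> nat"
  where "characteristic R = group.ord (add_monoid R) \<one>\<^bsub>R\<^esub>"

definition inverse_set :: "('a, 'b) ring_scheme \<Rightarrow> 'a set \<Rightarrow> 'a set"
  where "inverse_set R S = {inv\<^bsub>R\<^esub> s | s. s \<in> S \<and> s \<noteq> \<zero>\<^bsub>R\<^esub>}"

definition inverse_closed :: "('a, 'b) ring_scheme \<Rightarrow> 'a set \<Rightarrow> bool"
  where "inverse_closed R S \<longleftrightarrow> inverse_set R S \<subseteq> S"

context ring
begin

definition is_basis :: "'a set \<Rightarrow> 'a set \<Rightarrow> 'a list \<Rightarrow> bool"
  where "is_basis K V Us \<longleftrightarrow> independent K Us \<and> Span K Us = V"

definition coords :: "'a set \<Rightarrow> 'a list \<Rightarrow> 'a \<Rightarrow> 'a list"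
  where "coords K Us v =
    (THE Ks. set Ks \<subseteq> K \<and> length Ks = length Us \<and> combine Ks Us = v)"

(* The sum of the diagonal entries of the matrix of f with respect to the basis Us,
   whose i-th column is the coordinate vector of f (Us ! i). *)
definition trace_wrt :: "'a set \<Rightarrow> 'a list \<Rightarrow> ('a \<Rightarrow> 'a) \<Rightarrow> 'a"
  where "trace_wrt K Us f = (\<Oplus>i\<in>{..<length Us}. coords K Us (f (Us ! i)) ! i)"

(* The trace of the K-linear map y \<mapsto> x \<otimes> y on L.  For a K-linear map the value of trace_wrt is
   the same for all bases, so the choice of the basis is immaterial. Meaningful only when
   L has finite dimension over K and x lies in L. *)
definition field_trace :: "'a set \<Rightarrow> 'a set \<Rightarrow> 'a \<Rightarrow> 'a"
  where "field_trace K L x = trace_wrt K (SOME Us. is_basis K L Us) (\<lambda>y. x \<otimes> y)"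

end

end

theory Submission
  imports Defs
begin

text \<open>
  Write \<open>A\<close> for the inverse-closed subgroup. Hua's identity
  \<open>a - inv (inv a + inv (inv b - a)) = a a b\<close> builds \<open>a a b\<close> from \<open>a\<close> and \<open>b\<close> by additions, subtractions
  and inversions only, so \<open>A\<close> contains \<open>a a b\<close> whenever it contains \<open>a\<close> and \<open>b\<close>. Polarising
  the square and dividing by two, which is possible inside \<open>A\<close> because \<open>a / 2 = a a (inv (a + a))\<close>,
  shows that \<open>A\<close> is closed under all ternary products \<open>a b c\<close> (\<open>triple_mult_closed\<close>).

  Now fix \<open>a \<in> A\<close>, \<open>a \<noteq> 0\<close>. Closure under ternary products and inverses makes \<open>K = a A\<close> a subfield
  (\<open>translate_is_subfield\<close>), and \<open>A = K a\<close> (\<open>multiples_of_translate\<close>). If \<open>1 \<in> A\<close>, the choice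
  \<open>a = 1\<close> shows that \<open>A\<close> itself is a subfield. If \<open>1 \<notin> A\<close>, then \<open>a \<notin> K\<close>, whereas \<open>a a \<in> K\<close>. So
  \<open>L = K a + K\<close> is a quadratic extension of \<open>K\<close>, obtained by adjoining a square root, and the trace of
  \<open>k a + u\<close> is \<open>2 u\<close>: its kernel is exactly \<open>K a = A\<close> (\<open>sqrt_extension_trace_zero\<close>).

  The trace is computed from an arbitrary basis of \<open>L\<close> over \<open>K\<close>. Instead of
  proving basis independence, \<open>field_trace_quadratic\<close> extracts from any basis the quadratic equation
  given by Cayley-Hamilton, \<open>x x = Tr(x) x + d\<close> with \<open>d \<in> K\<close>, together with \<open>Tr(x) = 2 x\<close> for \<open>x \<in> K\<close>.
  These two facts determine the elements of trace zero.
\<close>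

section \<open>Characteristic and inverses in fields\<close>

lemma (in field) nonzero_inv:
  assumes "x \<in> carrier R" "x \<noteq> \<zero>"
  shows "inv x \<in> carrier R" "x \<otimes> inv x = \<one>" "inv x \<otimes> x = \<one>"
proof -
  have "x \<in> Units R" using assms field_Units by blast
  then show "inv x \<in> carrier R" "x \<otimes> inv x = \<one>" "inv x \<otimes> x = \<one>" by simp_all
qed

lemma (in field) two_nonzero_of_characteristic:
  assumes "characteristic R \<noteq> 2"
  shows "\<one> \<oplus> \<one> \<noteq> \<zero>"
proof
  assume "\<one> \<oplus> \<one> = \<zero>"
  then have "[(2::nat)] \<cdot> \<one> = \<zero>" by (simp add: numeral_2_eq_2)
  then have "add.ord \<one> dvd 2"
    using add.pow_eq_id[OF one_closed] by simp
  moreover have "add.ord \<one> \<noteq> 1"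
    using add.pow_eq_id[OF one_closed, of 1] by simp
  ultimately show False
    using assms dvd_imp_le[of "add.ord \<one>" 2] unfolding characteristic_def
    by (cases "add.ord \<one>") auto
qed

section \<open>Hua's identity\<close>

text \<open>
  With \<open>c = inv b \<ominus> a\<close> the sum \<open>inv a \<oplus> inv c\<close> equals \<open>(a \<oplus> c) / (a c)\<close>, and \<open>a \<oplus> c = inv b\<close>. Hence its
  inverse is \<open>a b c = a \<ominus> a a b\<close>. The first two
  claims guarantee that only nonzero elements are inverted.
\<close>

lemma (in field) hua_identity:
  assumes a: "a \<in> carrier R" "a \<noteq> \<zero>" and b: "b \<in> carrier R" "b \<noteq> \<zero>"
    and ab: "a \<otimes> b \<noteq> \<one>"
  shows "inv b \<ominus> a \<noteq> \<zero>"
    and "inv a \<oplus> inv (inv b \<ominus> a) \<noteq> \<zero>"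
    and "a \<ominus> inv (inv a \<oplus> inv (inv b \<ominus> a)) = a \<otimes> a \<otimes> b"
proof -
  note ia = nonzero_inv[OF a] and ib = nonzero_inv[OF b]
  define c where "c = inv b \<ominus> a"
  have c: "c \<in> carrier R" using a b ib unfolding c_def by simp
  have bc: "b \<otimes> c = \<one> \<ominus> a \<otimes> b"
  proof -
    have "b \<otimes> c = b \<otimes> inv b \<ominus> a \<otimes> b"
      unfolding c_def using a b ib(1) by algebra
    then show ?thesis using ib by simp
  qed
  show c0: "inv b \<ominus> a \<noteq> \<zero>"
  proof
    assume "inv b \<ominus> a = \<zero>"
    then have "\<one> \<ominus> a \<otimes> b = \<zero>" using bc b unfolding c_def by simp
    then show False using ab a b by (simp add: r_right_minus_eq)
  qed
  note ic = nonzero_inv[OF c c0[folded c_def]]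
  define d where "d = a \<ominus> a \<otimes> a \<otimes> b"
  have d: "d \<in> carrier R" using a b unfolding d_def by simp
  have dabc: "d = a \<otimes> (b \<otimes> c)"
    unfolding d_def bc using a b by algebra
  have "(inv a \<oplus> inv c) \<otimes> (a \<otimes> (b \<otimes> c)) = (inv a \<otimes> a) \<otimes> (b \<otimes> c) \<oplus> (inv c \<otimes> c) \<otimes> (a \<otimes> b)"
    using a b c ia(1) ic(1) by algebra
  also have "\<dots> = (\<one> \<ominus> a \<otimes> b) \<oplus> a \<otimes> b"
    using a b ia ic unfolding bc by simp
  also have "\<dots> = \<one>" using a b by algebra
  finally have one: "(inv a \<oplus> inv c) \<otimes> d = \<one>" unfolding dabc .
  show "inv a \<oplus> inv (inv b \<ominus> a) \<noteq> \<zero>"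
    using one d unfolding c_def by auto
  have "inv (inv a \<oplus> inv c) = d"
    by (rule comm_inv_char) (use ia ic d one in auto)
  then show "a \<ominus> inv (inv a \<oplus> inv (inv b \<ominus> a)) = a \<otimes> a \<otimes> b"
    unfolding c_def[symmetric] d_def using a b by simp algebra
qed

section \<open>Inverse-closed subgroups and ternary products\<close>

context field
begin

context
  fixes A assumes A: "additive_subgroup A R" and inv_A: "inverse_closed R A"
begin

lemma subgroup_closed:
  shows "A \<subseteq> carrier R" "\<zero> \<in> A"
    and "x \<in> A \<Longrightarrow> y \<in> A \<Longrightarrow> x \<oplus> y \<in> A"
    and "x \<in> A \<Longrightarrow> \<ominus> x \<in> A"
    and "x \<in> A \<Longrightarrow> y \<in> A \<Longrightarrow> x \<ominus> y \<in> A"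
    and "x \<in> A \<Longrightarrow> x \<noteq> \<zero> \<Longrightarrow> inv x \<in> A"
proof -
  interpret A: additive_subgroup A R by (rule A)
  show "A \<subseteq> carrier R" "\<zero> \<in> A" and "x \<in> A \<Longrightarrow> y \<in> A \<Longrightarrow> x \<oplus> y \<in> A"
    using A.a_subset by auto
  show um: "x \<in> A \<Longrightarrow> \<ominus> x \<in> A" for x
    using subgroup.m_inv_closed[OF A.a_subgroup] by (simp add: a_inv_def)
  show "x \<in> A \<Longrightarrow> y \<in> A \<Longrightarrow> x \<ominus> y \<in> A"
    using um by (simp add: a_minus_def)
  show "x \<in> A \<Longrightarrow> x \<noteq> \<zero> \<Longrightarrow> inv x \<in> A"
    using inv_A unfolding inverse_closed_def inverse_set_def by blast
qed

text \<open>
  Where Hua's identity does not apply, the product is \<open>\<zero>\<close> or, for \<open>a \<otimes> b = \<one>\<close>, just \<open>a\<close>.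
\<close>

lemma square_mult_closed:
  assumes "a \<in> A" "b \<in> A"
  shows "a \<otimes> a \<otimes> b \<in> A"
proof -
  have C: "a \<in> carrier R" "b \<in> carrier R" using assms subgroup_closed(1) by auto
  consider "a = \<zero>" | "b = \<zero>" | "a \<noteq> \<zero>" "b \<noteq> \<zero>" "a \<otimes> b = \<one>"
    | "a \<noteq> \<zero>" "b \<noteq> \<zero>" "a \<otimes> b \<noteq> \<one>" by blast
  then show ?thesis
  proof cases
    case 4
    note hua = hua_identity[OF C(1) 4(1) C(2) 4(2,3)]
    have "inv a \<oplus> inv (inv b \<ominus> a) \<in> A"
      using assms 4 hua(1) by (intro subgroup_closed(3,5,6)) auto
    then show ?thesis
      using assms hua(2) subgroup_closed(5,6) unfolding hua(3)[symmetric] by auto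
  qed (use assms C subgroup_closed(2) in \<open>auto simp: m_assoc\<close>)
qed

text \<open>
  The half of \<open>a\<close> is \<open>a \<otimes> a \<otimes> inv (a \<oplus> a)\<close>, to which the preceding closure property applies.
\<close>

lemma half_closed:
  assumes two: "\<one> \<oplus> \<one> \<noteq> \<zero>" and "a \<in> A"
  obtains h where "h \<in> A" "h \<oplus> h = a"
proof (cases "a = \<zero>")
  case True
  then show ?thesis using that[of \<zero>] subgroup_closed(2) by simp
next
  case False
  have a: "a \<in> carrier R" using assms subgroup_closed(1) by auto
  have "a \<oplus> a = (\<one> \<oplus> \<one>) \<otimes> a" using a by algebra
  then have 2: "a \<oplus> a \<in> carrier R" "a \<oplus> a \<noteq> \<zero>"
    using two False a by (auto simp: integral_iff)
  note i = nonzero_inv[OF 2]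
  have "a \<otimes> a \<otimes> inv (a \<oplus> a) \<oplus> a \<otimes> a \<otimes> inv (a \<oplus> a) = a \<otimes> ((a \<oplus> a) \<otimes> inv (a \<oplus> a))"
    using a i(1) by algebra
  also have "\<dots> = a" using i a by simp
  finally show ?thesis
    using that square_mult_closed subgroup_closed(3,6) assms(2) 2(2) by blast
qed

lemma triple_mult_closed:
  assumes two: "\<one> \<oplus> \<one> \<noteq> \<zero>" and "a \<in> A" "b \<in> A" "c \<in> A"
  shows "a \<otimes> b \<otimes> c \<in> A"
proof -
  obtain h where h: "h \<in> A" "h \<oplus> h = a" using half_closed assms(1,2) by blast
  have C: "h \<in> carrier R" "b \<in> carrier R" "c \<in> carrier R"
    using h assms subgroup_closed(1) by auto
  (* Expanding (h + b)^2 leaves the mixed term 2 h b = a b. *)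
  have "a \<otimes> b \<otimes> c = ((h \<oplus> b) \<otimes> (h \<oplus> b) \<otimes> c \<ominus> h \<otimes> h \<otimes> c) \<ominus> b \<otimes> b \<otimes> c"
    unfolding h(2)[symmetric] using C by algebra
  then show ?thesis
    using h assms by (auto intro!: subgroup_closed(3,5) square_mult_closed)
qed

text \<open>
  Products and inverses in \<open>a \<otimes> A\<close> are \<open>a\<close> times a ternary product:
  \<open>(a x)(a y) = a (x a y)\<close> and \<open>inv (a x) = a (inv a inv a inv x)\<close>. Moreover \<open>\<one> = a (inv a)\<close>.
\<close>

lemma translate_is_subfield:
  assumes two: "\<one> \<oplus> \<one> \<noteq> \<zero>" and a: "a \<in> A" "a \<noteq> \<zero>"
  shows "subfield ((\<otimes>) a ` A) R"
proof (rule subfieldI'[OF subringI])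
  have aC: "a \<in> carrier R" using a subgroup_closed(1) by auto
  note i = nonzero_inv[OF aC a(2)]
  have iA: "inv a \<in> A" using a by (rule subgroup_closed(6))
  note tri = triple_mult_closed[OF two]
  note AC = subsetD[OF subgroup_closed(1)]
  show "(\<otimes>) a ` A \<subseteq> carrier R" using aC AC by auto
  show "\<one> \<in> (\<otimes>) a ` A" using i iA by force
  show "\<ominus> h \<in> (\<otimes>) a ` A" if "h \<in> (\<otimes>) a ` A" for h
  proof -
    from that obtain x where x: "x \<in> A" "h = a \<otimes> x" by blast
    then have "\<ominus> h = a \<otimes> (\<ominus> x)" using aC AC by (simp add: r_minus)
    then show ?thesis using x subgroup_closed(4) by blast
  qed
  show "h1 \<otimes> h2 \<in> (\<otimes>) a ` A" if "h1 \<in> (\<otimes>) a ` A" "h2 \<in> (\<otimes>) a ` A" for h1 h2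
  proof -
    from that obtain x y where x: "x \<in> A" "h1 = a \<otimes> x" "y \<in> A" "h2 = a \<otimes> y" by blast
    then have "h1 \<otimes> h2 = a \<otimes> (x \<otimes> a \<otimes> y)" using aC AC by (simp add: m_assoc)
    then show ?thesis using x a tri by blast
  qed
  show "h1 \<oplus> h2 \<in> (\<otimes>) a ` A" if "h1 \<in> (\<otimes>) a ` A" "h2 \<in> (\<otimes>) a ` A" for h1 h2
  proof -
    from that obtain x y where x: "x \<in> A" "h1 = a \<otimes> x" "y \<in> A" "h2 = a \<otimes> y" by blast
    then have "h1 \<oplus> h2 = a \<otimes> (x \<oplus> y)" using aC AC by (simp add: r_distr)
    then show ?thesis using x subgroup_closed(3) by blast
  qed
  show "inv k \<in> (\<otimes>) a ` A" if "k \<in> (\<otimes>) a ` A - {\<zero>}" for k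
  proof -
    from that obtain x where x: "x \<in> A" "k = a \<otimes> x" "k \<noteq> \<zero>" by blast
    have xC: "x \<in> carrier R" and x0: "x \<noteq> \<zero>" using x aC AC by auto
    note j = nonzero_inv[OF xC x0]
    let ?y = "inv a \<otimes> inv a \<otimes> inv x"
    have "k \<otimes> (a \<otimes> ?y) = (a \<otimes> inv a) \<otimes> (a \<otimes> inv a) \<otimes> (x \<otimes> inv x)"
      unfolding x(2) using aC xC i(1) j(1) by algebra
    also have "\<dots> = \<one>" using i j by simp
    finally have "inv k = a \<otimes> ?y"
      by (intro comm_inv_char) (use aC xC i j x in auto)
    moreover have "?y \<in> A" using tri iA subgroup_closed(6)[OF x(1) x0] by blast
    ultimately show ?thesis by blast
  qed
qed

text \<open>
  Multiplying \<open>a \<otimes> A\<close> by \<open>a\<close> gives back \<open>A\<close>: one inclusion is the ternary product \<open>a \<otimes> y \<otimes> a\<close>, and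
  conversely \<open>x\<close> comes from the ternary product \<open>y = inv a \<otimes> inv a \<otimes> x\<close>.
\<close>

lemma multiples_of_translate:
  assumes two: "\<one> \<oplus> \<one> \<noteq> \<zero>" and a: "a \<in> A" "a \<noteq> \<zero>"
  shows "(\<lambda>k. k \<otimes> a) ` ((\<otimes>) a ` A) = A"
proof
  have aC: "a \<in> carrier R" using a subgroup_closed(1) by auto
  note i = nonzero_inv[OF aC a(2)]
  note tri = triple_mult_closed[OF two]
  show "(\<lambda>k. k \<otimes> a) ` ((\<otimes>) a ` A) \<subseteq> A" using tri a by blast
  show "A \<subseteq> (\<lambda>k. k \<otimes> a) ` ((\<otimes>) a ` A)"
  proof
    fix x assume x: "x \<in> A"
    then have xC: "x \<in> carrier R" using subgroup_closed(1) by auto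
    let ?y = "inv a \<otimes> inv a \<otimes> x"
    have y: "?y \<in> A" using tri x subgroup_closed(6)[OF a] by blast
    have "(a \<otimes> ?y) \<otimes> a = (a \<otimes> inv a) \<otimes> (a \<otimes> inv a) \<otimes> x"
      using aC i(1) xC by algebra
    then have "x = (a \<otimes> ?y) \<otimes> a" using i xC by simp
    then show "x \<in> (\<lambda>k. k \<otimes> a) ` ((\<otimes>) a ` A)" using y by blast
  qed
qed

end

section \<open>The trace in quadratic extensions\<close>

lemma coords_spec:
  assumes K: "subfield K R" and B: "is_basis K V Us" and v: "v \<in> V"
  shows "set (coords K Us v) \<subseteq> K" "length (coords K Us v) = length Us"
    and "combine (coords K Us v) Us = v"
    and "\<And>Ks. set Ks \<subseteq> K \<Longrightarrow> length Ks = length Us \<Longrightarrow> combine Ks Us = v \<Longrightarrow> coords K Us v = Ks"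
proof -
  have ex: "\<exists>!Ks. set Ks \<subseteq> K \<and> length Ks = length Us \<and> combine Ks Us = v"
    using unique_decomposition[OF K, of Us v] B v unfolding is_basis_def by (simp add: eq_commute)
  show "set (coords K Us v) \<subseteq> K" "length (coords K Us v) = length Us"
    "combine (coords K Us v) Us = v"
    using theI'[OF ex] unfolding coords_def by auto
  show "coords K Us v = Ks"
    if "set Ks \<subseteq> K" "length Ks = length Us" "combine Ks Us = v" for Ks
    unfolding coords_def using the1_equality[OF ex] that by blast
qed

text \<open>
  For \<open>x e = p e \<oplus> q f\<close> and \<open>x f = r e \<oplus> s f\<close> the trace is \<open>p \<oplus> s\<close>, and multiplying
  \<open>(x \<ominus> p) e = q f\<close> by \<open>(x \<ominus> s) f = r e\<close> and cancelling \<open>e f\<close> gives the characteristic equation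
  \<open>(x \<ominus> p) (x \<ominus> s) = q r\<close>. For \<open>x \<in> K\<close> the matrix is diagonal, since coordinates are unique.
\<close>

lemma field_trace_quadratic:
  assumes K: "subfield K R" and L: "subfield L R" and dim: "dimension 2 K L"
    and x: "x \<in> L"
  shows "field_trace K L x \<in> K"
    and "\<exists>d\<in>K. x \<otimes> x = field_trace K L x \<otimes> x \<oplus> d"
    and "x \<in> K \<Longrightarrow> field_trace K L x = x \<oplus> x"
proof -
  define Us where "Us = (SOME Us. is_basis K L Us)"
  have "\<exists>Us. is_basis K L Us"
    using exists_base[OF K dim] unfolding is_basis_def by blast
  then have B: "is_basis K L Us" unfolding Us_def by (rule someI_ex)
  have indep: "independent K Us" and span: "Span K Us = L"
    using B unfolding is_basis_def by auto
  have "length Us = 2"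
    using dimension_is_inj[OF K dimensionI[OF K indep span] dim] .
  then obtain e f where Us: "Us = [e, f]"
    by (auto simp: numeral_2_eq_2 length_Suc_conv)
  note LC = subsetD[OF subfieldE(3)[OF L]] and KC = subsetD[OF subfieldE(3)[OF K]]
  have ef: "e \<in> L" "f \<in> L"
    using Span_base_incl[OF K, of Us] independent_in_carrier[OF indep] span Us by auto
  have nz: "f \<noteq> \<zero>" "e \<noteq> \<zero>"
  proof -
    show "f \<noteq> \<zero>"
      using independent_backwards(1)[of K f "[]"] independent_backwards(2)[of K e "[f]"] indep Us
      by auto
    have "e \<notin> Span K [f]" using independent_backwards(1)[of K e "[f]"] indep Us by auto
    then show "e \<noteq> \<zero>" using Span_subgroup_props(2)[OF K, of "[f]"] ef LC by auto
  qed
  note mL = subringE(6)[OF subfieldE(1)[OF L]]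
  have two: "\<exists>p q. p \<in> K \<and> q \<in> K \<and> coords K Us v = [p, q] \<and> v = p \<otimes> e \<oplus> q \<otimes> f"
    if v: "v \<in> L" for v
  proof -
    obtain p q where pq: "coords K Us v = [p, q]"
      using coords_spec(2)[OF K B v] Us by (auto simp: length_Suc_conv)
    then have "p \<in> K" "q \<in> K" using coords_spec(1)[OF K B v] by auto
    moreover have "v = p \<otimes> e \<oplus> q \<otimes> f"
      using coords_spec(3)[OF K B v] ef LC KC calculation unfolding pq unfolding Us by simp
    ultimately show ?thesis using pq by blast
  qed
  obtain p q where pq: "p \<in> K" "q \<in> K" "coords K Us (x \<otimes> e) = [p, q]" "x \<otimes> e = p \<otimes> e \<oplus> q \<otimes> f"
    using two[OF mL[OF x ef(1)]] by blast
  obtain r s where rs: "r \<in> K" "s \<in> K" "coords K Us (x \<otimes> f) = [r, s]" "x \<otimes> f = r \<otimes> e \<oplus> s \<otimes> f"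
    using two[OF mL[OF x ef(2)]] by blast
  note C = LC[OF x] LC[OF ef(1)] LC[OF ef(2)] KC[OF pq(1)] KC[OF pq(2)] KC[OF rs(1)] KC[OF rs(2)]
  have "{..<Suc (Suc 0)} = {0, Suc 0}" by auto
  then have tr: "field_trace K L x = p \<oplus> s"
    unfolding field_trace_def trace_wrt_def Us_def[symmetric]
    using pq(3) rs(3) C by (simp add: Us)
  note K_props = subringE[OF subfieldE(1)[OF K]]
  show "field_trace K L x \<in> K" unfolding tr using pq rs K_props(7) by blast
  have 1: "(x \<ominus> p) \<otimes> e = q \<otimes> f"
  proof -
    have "(x \<ominus> p) \<otimes> e = x \<otimes> e \<ominus> p \<otimes> e" using C by algebra
    also have "\<dots> = q \<otimes> f" unfolding pq(4) using C by algebra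
    finally show ?thesis .
  qed
  have 2: "(x \<ominus> s) \<otimes> f = r \<otimes> e"
  proof -
    have "(x \<ominus> s) \<otimes> f = x \<otimes> f \<ominus> s \<otimes> f" using C by algebra
    also have "\<dots> = r \<otimes> e" unfolding rs(4) using C by algebra
    finally show ?thesis .
  qed
  have "(e \<otimes> f) \<otimes> ((x \<ominus> p) \<otimes> (x \<ominus> s)) = ((x \<ominus> p) \<otimes> e) \<otimes> ((x \<ominus> s) \<otimes> f)"
    using C by algebra
  also have "\<dots> = (e \<otimes> f) \<otimes> (q \<otimes> r)" unfolding 1 2 using C by algebra
  finally have det: "(x \<ominus> p) \<otimes> (x \<ominus> s) = q \<otimes> r"
    using nz C by (subst (asm) m_lcancel) (auto simp: integral_iff)
  have "x \<otimes> x = (p \<oplus> s) \<otimes> x \<oplus> ((x \<ominus> p) \<otimes> (x \<ominus> s) \<ominus> p \<otimes> s)"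
    using C by algebra
  then have "x \<otimes> x = field_trace K L x \<otimes> x \<oplus> (q \<otimes> r \<ominus> p \<otimes> s)"
    unfolding det tr .
  moreover have "q \<otimes> r \<ominus> p \<otimes> s \<in> K"
    unfolding a_minus_def using pq rs K_props(5,6,7) by simp
  ultimately show "\<exists>d\<in>K. x \<otimes> x = field_trace K L x \<otimes> x \<oplus> d" by blast
  show "field_trace K L x = x \<oplus> x" if "x \<in> K"
  proof -
    have "coords K Us (x \<otimes> e) = [x, \<zero>]"
      by (rule coords_spec(4)[OF K B]) (use C that K_props(2) ef mL x in \<open>auto simp: Us\<close>)
    moreover have "coords K Us (x \<otimes> f) = [\<zero>, x]"
      by (rule coords_spec(4)[OF K B]) (use C that K_props(2) ef mL x in \<open>auto simp: Us\<close>)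
    ultimately show ?thesis unfolding tr using pq(3) rs(3) by simp
  qed
qed

section \<open>Adjoining a square root\<close>

context
  fixes K a
  assumes K: "subfield K R" and a: "a \<in> carrier R" "a \<notin> K" "a \<otimes> a \<in> K"
begin

lemma base_closed:
  shows "\<And>x. x \<in> K \<Longrightarrow> x \<in> carrier R" "\<zero> \<in> K" "\<one> \<in> K"
    and "\<And>x y. x \<in> K \<Longrightarrow> y \<in> K \<Longrightarrow> x \<oplus> y \<in> K"
    and "\<And>x y. x \<in> K \<Longrightarrow> y \<in> K \<Longrightarrow> x \<otimes> y \<in> K"
    and "\<And>x. x \<in> K \<Longrightarrow> \<ominus> x \<in> K"
    and "\<And>x y. x \<in> K \<Longrightarrow> y \<in> K \<Longrightarrow> x \<ominus> y \<in> K"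
  using subringE[OF subfieldE(1)[OF K]] unfolding a_minus_def by auto

lemma scaled_root_in_base:
  assumes "k \<in> K" "k \<otimes> a \<in> K"
  shows "k = \<zero>"
  using subfield_m_inv_simprule[OF K, of k a] assms a by blast

text \<open>
  The inverse of \<open>h = k a \<oplus> u\<close> is the conjugate \<open>g = u \<ominus> k a\<close> divided by the norm
  \<open>n = u u \<ominus> k k a a\<close>, which lies in \<open>K\<close>. The norm does not vanish because \<open>a \<notin> K\<close>.
\<close>

lemma sqrt_extension_subfield: "subfield (line_extension K a K) R"
proof (rule subfieldI'[OF subringI])
  let ?L = "line_extension K a K"
  note mem = line_extension_mem_iff[of _ K a K]
  note [simp] = base_closed(1)
  show "?L \<subseteq> carrier R"
    using line_extension_in_carrier a(1) subfieldE(3)[OF K] by blast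
  have "\<one> = \<zero> \<otimes> a \<oplus> \<one>" using a by simp
  then show "\<one> \<in> ?L" using mem base_closed(2,3) by blast
  show "\<ominus> h \<in> ?L" if "h \<in> ?L" for h
  proof -
    from that mem obtain k u where h: "k \<in> K" "u \<in> K" "h = k \<otimes> a \<oplus> u" by blast
    have "k \<in> carrier R" "u \<in> carrier R" using h by auto
    then have "\<ominus> h = (\<ominus> k) \<otimes> a \<oplus> (\<ominus> u)" unfolding h(3) using a(1) by algebra
    then show ?thesis using mem h base_closed(6) by blast
  qed
  show "h1 \<oplus> h2 \<in> ?L" if "h1 \<in> ?L" "h2 \<in> ?L" for h1 h2
  proof -
    from that(1) mem obtain k u where h: "k \<in> K" "u \<in> K" "h1 = k \<otimes> a \<oplus> u" by blast
    from that(2) mem obtain l v where g: "l \<in> K" "v \<in> K" "h2 = l \<otimes> a \<oplus> v" by blast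
    have "k \<in> carrier R" "u \<in> carrier R" "l \<in> carrier R" "v \<in> carrier R" using h g by auto
    then have "h1 \<oplus> h2 = (k \<oplus> l) \<otimes> a \<oplus> (u \<oplus> v)"
      unfolding h(3) g(3) using a(1) by algebra
    then show ?thesis using mem h g base_closed(4) by blast
  qed
  show mult: "h1 \<otimes> h2 \<in> ?L" if "h1 \<in> ?L" "h2 \<in> ?L" for h1 h2
  proof -
    from that(1) mem obtain k u where h: "k \<in> K" "u \<in> K" "h1 = k \<otimes> a \<oplus> u" by blast
    from that(2) mem obtain l v where g: "l \<in> K" "v \<in> K" "h2 = l \<otimes> a \<oplus> v" by blast
    have "k \<in> carrier R" "u \<in> carrier R" "l \<in> carrier R" "v \<in> carrier R" using h g by auto
    then have "h1 \<otimes> h2 = (k \<otimes> v \<oplus> u \<otimes> l) \<otimes> a \<oplus> (k \<otimes> l \<otimes> (a \<otimes> a) \<oplus> u \<otimes> v)"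
      unfolding h(3) g(3) using a(1) by algebra
    moreover have "k \<otimes> v \<oplus> u \<otimes> l \<in> K" "k \<otimes> l \<otimes> (a \<otimes> a) \<oplus> u \<otimes> v \<in> K"
      using h(1,2) g(1,2) a(3) by (simp_all add: base_closed)
    ultimately show ?thesis using mem by blast
  qed
  show "inv h \<in> ?L" if "h \<in> ?L - {\<zero>}" for h
  proof -
    from that mem obtain k u where h: "k \<in> K" "u \<in> K" "h = k \<otimes> a \<oplus> u" "h \<noteq> \<zero>" by blast
    have C: "k \<in> carrier R" "u \<in> carrier R" "h \<in> carrier R" using h a(1) by auto
    define g where "g = (\<ominus> k) \<otimes> a \<oplus> u"
    define n where "n = u \<otimes> u \<ominus> k \<otimes> k \<otimes> (a \<otimes> a)"
    have g: "g \<in> ?L" "g \<in> carrier R" unfolding g_def using C a(1) mem h base_closed(6) by auto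
    have n: "n \<in> K" "n = h \<otimes> g"
    proof -
      show "n \<in> K" unfolding n_def using h(1,2) a(3) by (simp add: base_closed)
      show "n = h \<otimes> g" unfolding n_def h(3) g_def using C(1,2) a(1) by algebra
    qed
    have "g \<noteq> \<zero>"
    proof
      assume g0: "g = \<zero>"
      have "k \<otimes> a = u \<ominus> g" unfolding g_def using C(1,2) a(1) by algebra
      then have "k \<otimes> a = u" using C unfolding g0 by (simp add: a_minus_def)
      then show False using scaled_root_in_base[of k] h C a(1) by auto
    qed
    then have n0: "n \<noteq> \<zero>" using n h(4) C g by (simp add: integral_iff)
    have nC: "n \<in> carrier R" using n by simp
    note i = nonzero_inv[OF nC n0]
    have "h \<otimes> (g \<otimes> inv n) = n \<otimes> inv n" unfolding n(2)
      using n C g i by (simp add: m_assoc)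
    then have "inv h = g \<otimes> inv n"
      by (intro comm_inv_char) (use C g i in auto)
    moreover have "inv n \<in> ?L"
    proof -
      have "inv n \<in> K" using subfield_m_inv[OF K] n n0 by blast
      moreover have "inv n = \<zero> \<otimes> a \<oplus> inv n" using i a(1) by simp
      ultimately show ?thesis using mem base_closed(2) by blast
    qed
    ultimately show ?thesis using mult g by simp
  qed
qed

lemma sqrt_extension_dimension: "dimension 2 K (line_extension K a K)"
  using Suc_dim[OF a(1,2) dimension_one[OF K]] by (simp add: numeral_2_eq_2)

lemma base_subset_sqrt_extension: "K \<subseteq> line_extension K a K"
proof
  fix u assume u: "u \<in> K"
  then have "u = \<zero> \<otimes> a \<oplus> u" using a(1) base_closed(1) by simp
  then show "u \<in> line_extension K a K"
    using u base_closed(2) line_extension_mem_iff by blast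
qed

text \<open>
  By the quadratic equation, an element \<open>x = k a \<oplus> u\<close> of trace zero has its square in \<open>K\<close>. The component
  of that square along \<open>a\<close> is \<open>2 k u\<close>, so \<open>k = \<zero>\<close> or \<open>u = \<zero>\<close>, and the first also leads to
  \<open>u = \<zero>\<close> because the trace of \<open>u \<in> K\<close> is \<open>2 u\<close>. Conversely the square of \<open>k a\<close> lies in \<open>K\<close>, so the
  equation puts \<open>Tr(k a) k a\<close> into \<open>K\<close>, which forces \<open>Tr(k a) = \<zero>\<close> or \<open>k = \<zero>\<close>, and the
  trace of \<open>\<zero>\<close> is \<open>\<zero>\<close> as well.
\<close>

lemma sqrt_extension_trace_zero:
  assumes two: "\<one> \<oplus> \<one> \<noteq> \<zero>"
  shows "{x \<in> line_extension K a K. field_trace K (line_extension K a K) x = \<zero>}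
    = (\<lambda>k. k \<otimes> a) ` K"
proof -
  let ?L = "line_extension K a K"
  let ?t = "field_trace K ?L"
  note mem = line_extension_mem_iff[of _ K a K]
  note tr = field_trace_quadratic[OF K sqrt_extension_subfield sqrt_extension_dimension]
  have double: "u = \<zero>" if "u \<in> carrier R" "u \<oplus> u = \<zero>" for u
  proof -
    have "(\<one> \<oplus> \<one>) \<otimes> u = u \<oplus> u" using that(1) by algebra
    then show ?thesis using that two by (simp add: integral_iff)
  qed
  have "x \<in> (\<lambda>k. k \<otimes> a) ` K" if x: "x \<in> ?L" and t: "?t x = \<zero>" for x
  proof -
    obtain k u where h: "k \<in> K" "u \<in> K" "x = k \<otimes> a \<oplus> u" using x mem by blast
    have C: "k \<in> carrier R" "u \<in> carrier R" using h base_closed(1) by auto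
    then have xC: "x \<in> carrier R" using h a(1) by simp
    obtain d where d: "d \<in> K" "x \<otimes> x = ?t x \<otimes> x \<oplus> d" using tr(2)[OF x] by blast
    then have sq: "x \<otimes> x \<in> K" using t xC base_closed(1) by simp
    have "(k \<otimes> u \<oplus> k \<otimes> u) \<otimes> a = x \<otimes> x \<ominus> (k \<otimes> k \<otimes> (a \<otimes> a) \<oplus> u \<otimes> u)"
      unfolding h(3) using C a(1) by algebra
    also have "\<dots> \<in> K"
      using sq h(1,2) a(3) by (simp add: base_closed)
    finally have "k \<otimes> u \<oplus> k \<otimes> u = \<zero>"
      using scaled_root_in_base h base_closed(4,5) by blast
    then have "k \<otimes> u = \<zero>" by (rule double[OF m_closed[OF C]])
    then have "k = \<zero> \<or> u = \<zero>" using C by (simp add: integral_iff)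
    then have "u = \<zero>"
    proof
      assume "k = \<zero>"
      then have "x = u" using h C a(1) by simp
      then have "u \<oplus> u = \<zero>" using tr(3)[OF x] t h(2) by simp
      then show "u = \<zero>" by (rule double[OF C(2)])
    qed
    then show ?thesis using h C a(1) by simp
  qed
  moreover have "k \<otimes> a \<in> ?L \<and> ?t (k \<otimes> a) = \<zero>" if k: "k \<in> K" for k
  proof -
    have C: "k \<in> carrier R" using k base_closed(1) by auto
    have "k \<otimes> a = k \<otimes> a \<oplus> \<zero>" using C a(1) by simp
    then have x: "k \<otimes> a \<in> ?L" using mem k base_closed(2) by blast
    obtain d where d: "d \<in> K" "k \<otimes> a \<otimes> (k \<otimes> a) = ?t (k \<otimes> a) \<otimes> (k \<otimes> a) \<oplus> d"
      using tr(2)[OF x] by blast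
    have T: "?t (k \<otimes> a) \<in> K" using tr(1)[OF x] .
    note C' = C base_closed(1)[OF T] base_closed(1)[OF d(1)]
    have "?t (k \<otimes> a) \<otimes> k \<otimes> a = k \<otimes> a \<otimes> (k \<otimes> a) \<ominus> d"
      unfolding d(2) using C' a(1) by algebra
    also have "\<dots> = k \<otimes> k \<otimes> (a \<otimes> a) \<ominus> d"
      using C' a(1) by algebra
    also have "\<dots> \<in> K" using k d(1) a(3) by (simp add: base_closed)
    finally have "?t (k \<otimes> a) \<otimes> k = \<zero>"
      using scaled_root_in_base T k base_closed(5) by blast
    then consider "?t (k \<otimes> a) = \<zero>" | "k = \<zero>" using C' by (auto simp: integral_iff)
    then have "?t (k \<otimes> a) = \<zero>"
    proof cases
      case 2
      then show ?thesis using tr(3)[OF x] k a(1) by simp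
    qed
    then show ?thesis using x by blast
  qed
  ultimately show ?thesis by blast
qed

end

end

section \<open>Classification of inverse-closed subgroups\<close>

theorem theorem1:
  fixes E :: "('a, 'b) ring_scheme" and A :: "'a set"
  assumes "field E"
    and "characteristic E \<noteq> 2"
    and "additive_subgroup A E"
    and "A \<noteq> {\<zero>\<^bsub>E\<^esub>}"
    and "inverse_closed E A"
  shows "subfield A E \<or>
    (\<exists>K L. subfield K E \<and> subfield L E \<and> K \<subseteq> L \<and> ring.dimension E 2 K L \<and>
       A = {x \<in> L. ring.field_trace E K L x = \<zero>\<^bsub>E\<^esub>})"
proof -
  interpret field E by (rule assms(1))
  note A = assms(3,5)
  note two = two_nonzero_of_characteristic[OF assms(2)]
  note AC = subsetD[OF subgroup_closed(1)[OF A]]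
  show ?thesis
  proof (cases "\<one>\<^bsub>E\<^esub> \<in> A")
    case True
    have "(\<otimes>\<^bsub>E\<^esub>) \<one>\<^bsub>E\<^esub> ` A = A" using AC by (simp add: image_def)
    then show ?thesis using translate_is_subfield[OF A two True] by simp
  next
    case False
    obtain a where a: "a \<in> A" "a \<noteq> \<zero>\<^bsub>E\<^esub>" using assms(4) subgroup_closed(2)[OF A] by blast
    have aC: "a \<in> carrier E" using a AC by blast
    define K where "K = (\<otimes>\<^bsub>E\<^esub>) a ` A"
    have K: "subfield K E" unfolding K_def using translate_is_subfield[OF A two a] .
    have aK: "a \<notin> K"
    proof
      assume "a \<in> K"
      then obtain x where x: "x \<in> A" "a = a \<otimes>\<^bsub>E\<^esub> x" unfolding K_def by blast
      then have "x = \<one>\<^bsub>E\<^esub>" using m_lcancel[OF a(2) aC AC[OF x(1)] one_closed] aC by simp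
      then show False using False x by simp
    qed
    have sq: "a \<otimes>\<^bsub>E\<^esub> a \<in> K" unfolding K_def using a by blast
    note ext = K aC aK sq
    have "A = (\<lambda>k. k \<otimes>\<^bsub>E\<^esub> a) ` K"
      unfolding K_def by (rule multiples_of_translate[OF A two a, symmetric])
    then show ?thesis
      using K sqrt_extension_subfield[OF ext] base_subset_sqrt_extension[OF ext]
        sqrt_extension_dimension[OF ext] sqrt_extension_trace_zero[OF ext two] by blast
  qed
qed

end
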